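(* Let $\alpha,\beta\in\mathbb{R}$. The double inequality $$\alpha\left[\tfrac13 Q(a,b)+\tfrac23 A(a,b)\right]+(1-\alpha)Q^{1/3}(a,b)A^{2/3}(a,b)<M(a,b)<\beta\left[\tfrac13 Q(a,b)+\tfrac23 A(a,b)\right]+(1-\beta)Q^{1/3}(a,b)A^{2/3}(a,b)$$ holds for all $a,b>0$ with $a\neq b$ if and only if $$\alpha\leq \frac{3-3\sqrt[6]{2}\,\log(1+\sqrt{2})}{(2+\sqrt{2}-3\sqrt[6]{2})\log(1+\sqrt{2})}=0.777\cdots\quad\text{and}\quad \beta\geq \frac45.$$
   Context: For $a,b>0$ with $a\neq b$: the Neuman-Sándor mean is $M(a,b)=\dfrac{a-b}{2\,\mathrm{arcsinh}\left(\frac{a-b}{a+b}\right)}$, where $\mathrm{arcsinh}$ is the inverse hyperbolic sine; the arithmetic mean is $A(a,b)=\frac{a+b}{2}$; the quadratic mean is $Q(a,b)=\sqrt{\frac{a^2+b^2}{2}}$. The notation $Q^{1/3}(a,b)$ means $(Q(a,b))^{1/3}$, and similarly for other powers. $\log$ is the natural logarithm. *)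

theory Defs
  imports Complex_Main
begin

text \<open>All means are meant for \<open>a, b > 0\<close> with \<open>a \<noteq> b\<close>; on the diagonal the formula for
  \<open>neuman_sandor_mean\<close> degenerates to \<open>0 / 0 = 0\<close>.\<close>

definition neuman_sandor_mean :: "real \<Rightarrow> real \<Rightarrow> real" where
  "neuman_sandor_mean a b = (a - b) / (2 * arsinh ((a - b) / (a + b)))"

definition arithmetic_mean :: "real \<Rightarrow> real \<Rightarrow> real" where
  "arithmetic_mean a b = (a + b) / 2"

definition quadratic_mean :: "real \<Rightarrow> real \<Rightarrow> real" where
  "quadratic_mean a b = sqrt ((a\<^sup>2 + b\<^sup>2) / 2)"

definition alpha_bound :: real where
  "alpha_bound = (3 - 3 * root 6 2 * ln (1 + sqrt 2)) /
     ((2 + sqrt 2 - 3 * root 6 2) * ln (1 + sqrt 2))"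

end

theory Submission
  imports Defs "HOL-Analysis.Harmonic_Numbers"
begin

text \<open>
  By homogeneity and symmetry one may take \<open>a = 1 + v\<close>, \<open>b = 1 - v\<close> with \<open>0 < v < 1\<close>. With
  \<open>x = (1 + v\<^sup>2) powr (1/6)\<close> and \<open>p(x) = \<lambda> (x\<^sup>3 + 2) / 3 + (1 - \<lambda>) x\<close> the comparison is between
  \<open>v / arsinh v\<close> and \<open>p(x)\<close>, that is, it concerns the sign of \<open>G(v) = arsinh v - v / p(x)\<close>.
  Here \<open>G(0) = 0\<close>, and \<open>G'(v)\<close> has the sign of a polynomial \<open>q\<close> in \<open>t = x - 1\<close> with constant
  term \<open>15 \<lambda> - 12\<close> and positive higher coefficients if \<open>\<lambda> \<ge> 3/4\<close>. So \<open>G\<close> increases for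
  \<open>\<lambda> = 4/5\<close>, it starts by decreasing if \<open>3/4 \<le> \<lambda> < 4/5\<close>, and when it vanishes at \<open>1\<close>, which is
  the case \<open>\<lambda> = alpha_bound\<close>, it is negative in between because \<open>G'\<close> changes sign at most once.
\<close>

section \<open>Algebra of the mixed mean and of the derivative's numerator\<close>

definition mix :: "real \<Rightarrow> real \<Rightarrow> real" where
  "mix l x = l * ((x^3 + 2) / 3) + (1 - l) * x"

text \<open>The polynomial q: what remains of the numerator of \<open>arsinh_gap\<close>'s
  derivative once its double root at x = 1 is removed, expanded in t = x - 1 so that the signs of
  the coefficients are visible.\<close>

definition mix_cofactor :: "real \<Rightarrow> real \<Rightarrow> real" where
  "mix_cofactor l t = (15*l - 12) + (40*l - 28)*t + (3*l^2 + 44*l - 27) * t^2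
     + (8*l^2 + 22*l - 12) * t^3 + (22/3*l^2 + 4*l - 2) * t^4 + 8/3*l^2*t^5 + l^2/3*t^6"

text \<open>For v = (a - b)/(a + b) this is the cube root of Q/A, so both means being mixed become A
  times a polynomial in it.\<close>

definition root6 :: "real \<Rightarrow> real" where
  "root6 v = (1 + v^2) powr (1/6)"

text \<open>Keeping \<open>arsinh\<close> as a bare summand makes the derivative algebraic in
  \<open>root6 v\<close> and v.\<close>

definition arsinh_gap :: "real \<Rightarrow> real \<Rightarrow> real" where
  "arsinh_gap l v = arsinh v - v / mix l (root6 v)"

lemma cubic_gt_linear:
  fixes x :: real
  assumes "x > 1"
  shows "x < (x^3 + 2) / 3"
proof -
  have "(x^3 + 2) / 3 - x = (x - 1)^2 * (x + 2) / 3"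
    by (simp add: power2_eq_square power3_eq_cube field_simps)
  also have "\<dots> > 0" using assms by simp
  finally show ?thesis by simp
qed

lemma mix_mono:
  assumes "l \<le> m" "x \<ge> 1"
  shows "mix l x \<le> mix m x"
proof -
  have "x \<le> (x^3 + 2) / 3"
    using cubic_gt_linear[of x] assms(2) by (cases "x = 1") auto
  then have "0 \<le> (m - l) * ((x^3 + 2) / 3 - x)"
    using assms by (intro mult_nonneg_nonneg) auto
  also have "\<dots> = mix m x - mix l x" by (simp add: mix_def) algebra
  finally show ?thesis by simp
qed

lemma mix_pos:
  assumes "l \<ge> 0" "x \<ge> 1"
  shows "mix l x > 0"
  using mix_mono[OF assms] assms(2) by (simp add: mix_def)

text \<open>With v^2 = x^6 - 1 the left side is the numerator of the derivative of
  \<open>arsinh_gap\<close>. The double root reflects that \<open>mix l (root6 v)\<close> and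
  \<open>v / arsinh v\<close> agree to order v^2 at 0 for every l.\<close>

lemma mix_cofactor_identity:
  "3*x^2*(mix l x)^2 - 3*x^5*mix l x + (x^6 - 1)*(l*x^2 + (1 - l))
     = (x - 1)^2 * mix_cofactor l (x - 1)"
  unfolding mix_def mix_cofactor_def
  by (simp add: field_simps) algebra

lemma mix_cofactor_strict_mono:
  assumes "l \<ge> 3/4" "0 \<le> s" "s < t"
  shows "mix_cofactor l s < mix_cofactor l t"
proof -
  have l2: "l^2 \<ge> 9/16"
    using power_mono[of "3/4" l 2] assms by (simp add: power2_eq_square)
  have pow: "s^n \<le> t^n" for n
    using assms by (intro power_mono) auto
  \<comment> \<open>Strictness comes from the linear term, whose coefficient is at least 2.\<close>
  have "(40*l - 28) * s < (40*l - 28) * t"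
    using assms by (intro mult_strict_left_mono) auto
  moreover have "(3*l^2 + 44*l - 27) * s^2 \<le> (3*l^2 + 44*l - 27) * t^2"
    using assms l2 by (intro mult_left_mono pow) linarith
  moreover have "(8*l^2 + 22*l - 12) * s^3 \<le> (8*l^2 + 22*l - 12) * t^3"
    using assms l2 by (intro mult_left_mono pow) linarith
  moreover have "(22/3*l^2 + 4*l - 2) * s^4 \<le> (22/3*l^2 + 4*l - 2) * t^4"
    using assms l2 by (intro mult_left_mono pow) linarith
  moreover have "8/3*l^2 * s^5 \<le> 8/3*l^2*t^5" "l^2/3 * s^6 \<le> l^2/3*t^6"
    by (intro mult_left_mono pow; simp)+
  ultimately show ?thesis unfolding mix_cofactor_def by linarith
qed

section \<open>The substitution x = (1 + v^2)^(1/6)\<close>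

lemma root6_power6: "root6 v ^ 6 = 1 + v^2"
proof -
  have "1 + v^2 > 0" by (simp add: add_pos_nonneg)
  then show ?thesis unfolding root6_def by (simp add: powr_power)
qed

lemma root6_power3: "root6 v ^ 3 = sqrt (1 + v^2)"
proof -
  have "1 + v^2 > 0" by (simp add: add_pos_nonneg)
  then show ?thesis unfolding root6_def by (simp add: powr_power powr_half_sqrt)
qed

lemma root6_ge_1: "root6 v \<ge> 1"
  unfolding root6_def by (intro ge_one_powr_ge_zero) auto

lemma root6_strict_mono:
  assumes "0 \<le> u" "u < v"
  shows "root6 u < root6 v"
  unfolding root6_def using assms
  by (intro powr_less_mono2) (auto intro: power_strict_mono simp: add_nonneg_nonneg)

lemma root6_0: "root6 0 = 1"
  by (simp add: root6_def)

lemma root6_gt_1: "v > 0 \<Longrightarrow> root6 v > 1"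
  using root6_strict_mono[of 0 v] by (simp add: root6_0)

lemma root6_abs: "root6 \<bar>v\<bar> = root6 v"
  by (simp add: root6_def)

lemma root6_1: "root6 1 = root 6 2"
  by (simp add: root6_def root_powr_inverse)

lemma has_real_derivative_root6:
  "(root6 has_real_derivative v / (3 * root6 v ^ 5)) (at v)"
proof -
  have pos: "1 + v^2 > 0" by (simp add: add_pos_nonneg)
  have eq: "(1 + v^2) powr (1/6 - 1) = 1 / root6 v ^ 5"
  proof -
    have "(1 + v^2) powr (1/6 - 1) = root6 v / root6 v ^ 6"
      using pos unfolding root6_power6 by (subst powr_diff) (simp add: root6_def)
    then show ?thesis using root6_ge_1[of v] by (simp add: field_simps eval_nat_numeral)
  qed
  have "(root6 has_real_derivative 1/6 * (1 + v^2) powr (1/6 - 1) * (2 * v)) (at v)"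
    unfolding root6_def[abs_def] using pos
    by (auto intro!: derivative_eq_intros simp: powr_diff field_simps)
  then show ?thesis unfolding eq by simp
qed

section \<open>Derivative and sign of the gap function\<close>

lemma has_real_derivative_arsinh_gap:
  assumes "l \<ge> 0"
  shows "(arsinh_gap l has_real_derivative
      (root6 v - 1)^2 * mix_cofactor l (root6 v - 1) / (3 * root6 v ^ 5 * (mix l (root6 v))^2)) (at v)"
proof -
  define x where "x = root6 v"
  define m where "m = mix l x"
  have x: "x \<ge> 1" by (simp add: x_def root6_ge_1)
  have m: "m > 0" using mix_pos[OF assms x] by (simp add: m_def)
  have "((\<lambda>v. mix l (root6 v)) has_real_derivative (l*x^2 + (1 - l)) * (v / (3 * x^5))) (at v)"
    unfolding mix_def[abs_def] x_def
    by (auto intro!: derivative_eq_intros has_real_derivative_root6 simp: algebra_simps add_divide_distrib diff_divide_distrib)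
  then have "(arsinh_gap l has_real_derivative
      1 / x^3 - (m - v * ((l*x^2 + (1 - l)) * (v / (3 * x^5)))) / (m * m)) (at v)"
    unfolding arsinh_gap_def[abs_def] using m
    by (auto simp: m_def x_def root6_power3 add.commute intro!: derivative_eq_intros)
  also have "1 / x^3 - (m - v * ((l*x^2 + (1 - l)) * (v / (3 * x^5)))) / (m * m)
      = (3*x^2*m^2 - 3*x^5*m + v^2*(l*x^2 + (1 - l))) / (3 * x^5 * m^2)"
    using x m by (simp add: divide_simps) algebra
  also have "v^2 = x^6 - 1" by (simp add: x_def root6_power6)
  also have "3*x^2*m^2 - 3*x^5*m + (x^6 - 1)*(l*x^2 + (1 - l)) = (x - 1)^2 * mix_cofactor l (x - 1)"
    unfolding m_def by (rule mix_cofactor_identity)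
  finally show ?thesis by (simp add: x_def m_def)
qed

text \<open>Mean value theorem with the positive factors of the derivative absorbed into c: an
  increment of the gap has the sign of the cofactor at an interior point.\<close>

lemma arsinh_gap_MVT:
  assumes "l \<ge> 0" "0 \<le> u" "u < v"
  obtains w c where "u < w" "w < v" "c > 0"
    "arsinh_gap l v - arsinh_gap l u = c * mix_cofactor l (root6 w - 1)"
proof -
  obtain w where w: "u < w" "w < v" and eq: "arsinh_gap l v - arsinh_gap l u = (v - u) *
      ((root6 w - 1)^2 * mix_cofactor l (root6 w - 1) / (3 * root6 w ^ 5 * (mix l (root6 w))^2))"
    using MVT2[OF assms(3) has_real_derivative_arsinh_gap[OF assms(1)]] by blast
  have x: "root6 w > 1" using w assms by (intro root6_gt_1) auto
  have "mix l (root6 w) > 0" using x assms by (intro mix_pos) auto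
  with x assms show ?thesis
    by (intro that[OF w, of "(v - u) * (root6 w - 1)^2 / (3 * root6 w ^ 5 * (mix l (root6 w))^2)"])
       (auto simp: eq)
qed

lemma arsinh_gap_0: "arsinh_gap l 0 = 0"
  by (simp add: arsinh_gap_def)

text \<open>At l = 4/5 the constant term 15*l - 12 vanishes, so the increasing cofactor is positive
  for t > 0.\<close>

lemma arsinh_gap_four_fifths_pos:
  assumes "v > 0"
  shows "arsinh_gap (4/5) v > 0"
proof -
  obtain w c where wc: "0 < w" "c > 0"
    "arsinh_gap (4/5) v - arsinh_gap (4/5) 0 = c * mix_cofactor (4/5) (root6 w - 1)"
    by (rule arsinh_gap_MVT[of "4/5" 0 v]) (use assms in auto)
  have "mix_cofactor (4/5) 0 < mix_cofactor (4/5) (root6 w - 1)"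
    using root6_gt_1[OF wc(1)] by (intro mix_cofactor_strict_mono) auto
  with wc show ?thesis by (simp add: arsinh_gap_0 mix_cofactor_def)
qed

lemma arsinh_gap_neg_near_0:
  assumes "3/4 \<le> l" "l < 4/5"
  obtains v where "0 < v" "v < 1" "arsinh_gap l v < 0"
proof -
  have "isCont (\<lambda>v. mix_cofactor l (root6 v - 1)) 0"
    unfolding mix_cofactor_def
    by (intro continuous_intros DERIV_isCont[OF has_real_derivative_root6])
  moreover have "mix_cofactor l (root6 0 - 1) < 0"
    using assms by (simp add: root6_0 mix_cofactor_def)
  ultimately have "\<forall>\<^sub>F v in at 0. mix_cofactor l (root6 v - 1) < 0"
    unfolding isCont_def by (rule order_tendstoD)
  then obtain d where d: "d > 0" "\<And>v. v \<noteq> 0 \<Longrightarrow> \<bar>v\<bar> < d \<Longrightarrow> mix_cofactor l (root6 v - 1) < 0"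
    unfolding eventually_at by (auto simp: dist_real_def)
  \<comment> \<open>Below d, where the cofactor is negative, and below 1, as the conclusion
    demands.\<close>
  define v where "v = min (d/2) (1/2)"
  have v: "0 < v" "v < 1" "v < d" using d(1) by (auto simp: v_def min_def)
  obtain w c where wc: "0 < w" "w < v" "c > 0"
    "arsinh_gap l v - arsinh_gap l 0 = c * mix_cofactor l (root6 w - 1)"
    by (rule arsinh_gap_MVT[of l 0 v]) (use assms v in auto)
  have "mix_cofactor l (root6 w - 1) < 0" using wc v by (intro d(2)) auto
  with wc v show ?thesis by (intro that[of v]) (simp_all add: arsinh_gap_0 mult_pos_neg)
qed

text \<open>A nonnegative value at v would force a cofactor \<ge> 0 somewhere in (0, v) and \<le> 0
  somewhere in (v, 1), against strict monotonicity.\<close>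

lemma arsinh_gap_neg_if_zero_at_1:
  assumes "l \<ge> 3/4" "arsinh_gap l 1 = 0" "0 < v" "v < 1"
  shows "arsinh_gap l v < 0"
proof (rule ccontr)
  assume neg: "\<not> arsinh_gap l v < 0"
  obtain w c where wc: "0 < w" "w < v" "c > 0"
    "arsinh_gap l v - arsinh_gap l 0 = c * mix_cofactor l (root6 w - 1)"
    by (rule arsinh_gap_MVT[of l 0 v]) (use assms in auto)
  obtain z k where zk: "v < z" "k > 0"
    "arsinh_gap l 1 - arsinh_gap l v = k * mix_cofactor l (root6 z - 1)"
    by (rule arsinh_gap_MVT[of l v 1]) (use assms in auto)
  have "mix_cofactor l (root6 w - 1) < mix_cofactor l (root6 z - 1)"
    using root6_strict_mono[of w z] root6_ge_1[of w] wc zk assms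
    by (intro mix_cofactor_strict_mono) auto
  moreover have "0 \<le> mix_cofactor l (root6 w - 1)"
    using wc neg by (auto simp: arsinh_gap_0 not_less zero_le_mult_iff)
  moreover have "mix_cofactor l (root6 z - 1) \<le> 0"
    using zk neg assms(2) by (smt (verit) mult_pos_pos)
  ultimately show False by simp
qed

lemma mix_less_iff_arsinh_gap:
  assumes "l \<ge> 0" "v > 0"
  shows "mix l (root6 v) < v / arsinh v \<longleftrightarrow> arsinh_gap l v < 0"
    and "v / arsinh v < mix l (root6 v) \<longleftrightarrow> arsinh_gap l v > 0"
proof -
  have "mix l (root6 v) > 0" using assms by (intro mix_pos root6_ge_1)
  moreover have "arsinh v > 0" using assms by simp
  ultimately show "mix l (root6 v) < v / arsinh v \<longleftrightarrow> arsinh_gap l v < 0"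
    and "v / arsinh v < mix l (root6 v) \<longleftrightarrow> arsinh_gap l v > 0"
    by (auto simp: arsinh_gap_def field_simps)
qed

section \<open>The endpoint v = 1 and numerical bounds\<close>

lemma arsinh_1: "arsinh (1::real) = ln (1 + sqrt 2)"
  by (simp add: arsinh_real_def)

text \<open>\<open>alpha_bound\<close> is a quotient of two small differences, roughly 0.032 /
  0.041, so its third decimal calls for about six digits of each constant.\<close>

lemma sqrt_2_bounds: "14142135 / 10000000 < sqrt 2" "sqrt 2 < 14142136 / 10000000"
  by (rule real_less_rsqrt real_less_lsqrt; simp add: power2_eq_square)+

lemma root6_1_bounds: "1122462 / 1000000 < root6 1" "root6 1 < 11224621 / 10000000"
proof -
  have eq: "root6 1 ^ 6 = 2" by (simp add: root6_power6)
  show "1122462 / 1000000 < root6 1"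
    by (rule power_less_imp_less_base[of _ 6], unfold eq) (use root6_ge_1[of 1] in \<open>auto simp: eval_nat_numeral\<close>)
  show "root6 1 < 11224621 / 10000000"
    by (rule power_less_imp_less_base[of _ 6], unfold eq) (auto simp: eval_nat_numeral)
qed

text \<open>\<open>1393 / 577\<close> and \<open>3363 / 1393\<close> are consecutive convergents of \<open>1 + sqrt 2\<close>.\<close>

lemma ln_1_plus_sqrt_2_bounds:
  "88137 / 100000 < ln (1 + sqrt 2)" "ln (1 + sqrt 2) < 881374 / 1000000"
proof -
  have upto: "{..<8} = {0, 1, 2, 3, 4, 5, 6, 7::nat}" by auto
  have "88137 / 100000 < ln (1393 / 577 :: real)"
    using ln_approx_bounds[of "1393 / 577" 8] by (simp add: upto power_divide)
  also have "\<dots> < ln (1 + sqrt 2)" using sqrt_2_bounds by simp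
  finally show "88137 / 100000 < ln (1 + sqrt 2)" .
  have "ln (1 + sqrt 2) < ln (3363 / 1393)" using sqrt_2_bounds by simp
  also have "\<dots> < (881374 / 1000000 :: real)"
    using ln_approx_bounds[of "3363 / 1393" 8] by (simp add: upto power_divide)
  finally show "ln (1 + sqrt 2) < 881374 / 1000000" .
qed

text \<open>\<open>mix l (root6 1)\<close> is affine in l with positive slope, and
  \<open>alpha_bound\<close> solves the equation with \<open>1 / arsinh 1\<close>.\<close>

lemma mix_at_1_le_iff:
  "mix l (root6 1) \<le> 1 / arsinh 1 \<longleftrightarrow> l \<le> alpha_bound"
  "1 / arsinh 1 \<le> mix l (root6 1) \<longleftrightarrow> alpha_bound \<le> l"
proof -
  have r3: "root6 1 ^ 3 = sqrt 2" by (simp add: root6_power3)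
  have "2 + sqrt 2 - 3 * root6 1 > 0" using sqrt_2_bounds root6_1_bounds by linarith
  moreover have "ln (1 + sqrt 2) > 0" using ln_1_plus_sqrt_2_bounds by linarith
  ultimately have D: "(2 + sqrt 2 - 3 * root6 1) * ln (1 + sqrt 2) > 0" and L: "ln (1 + sqrt 2) > 0"
    by simp_all
  from L have
    "mix l (root6 1) \<le> 1 / arsinh 1 \<longleftrightarrow> l * ((2 + sqrt 2 - 3 * root6 1) * ln (1 + sqrt 2))
       \<le> 3 - 3 * root6 1 * ln (1 + sqrt 2)"
    "1 / arsinh 1 \<le> mix l (root6 1) \<longleftrightarrow> 3 - 3 * root6 1 * ln (1 + sqrt 2) \<le>
      l * ((2 + sqrt 2 - 3 * root6 1) * ln (1 + sqrt 2))"
    by (auto simp: mix_def r3 arsinh_1 field_simps)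
  with D show "mix l (root6 1) \<le> 1 / arsinh 1 \<longleftrightarrow> l \<le> alpha_bound"
    "1 / arsinh 1 \<le> mix l (root6 1) \<longleftrightarrow> alpha_bound \<le> l"
    by (simp_all add: alpha_bound_def root6_1[symmetric] pos_le_divide_eq pos_divide_le_eq)
qed

text \<open>By \<open>mix_at_1_le_iff\<close> it is enough to compare \<open>mix\<close> at 0.777
  and 0.778 with \<open>1 / arsinh 1\<close>, which avoids estimating the quotient itself.\<close>

lemma alpha_bound_bounds: "777 / 1000 \<le> alpha_bound" "alpha_bound < 778 / 1000"
proof -
  have r3: "root6 1 ^ 3 = sqrt 2" by (simp add: root6_power3)
  have L: "ln (1 + sqrt 2) > 0" using ln_1_plus_sqrt_2_bounds by linarith
  have "mix (777 / 1000) (root6 1) \<le> 1 / (881374 / 1000000)"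
    unfolding mix_def r3 using sqrt_2_bounds root6_1_bounds by (simp add: field_simps)
  also have "\<dots> \<le> 1 / arsinh 1"
    unfolding arsinh_1 using ln_1_plus_sqrt_2_bounds L by (intro divide_left_mono) auto
  finally show "777 / 1000 \<le> alpha_bound" by (simp only: mix_at_1_le_iff)
  have "1 / arsinh 1 \<le> 1 / (88137 / 100000::real)"
    unfolding arsinh_1 using ln_1_plus_sqrt_2_bounds L by (intro divide_left_mono) auto
  also have "\<dots> < mix (778 / 1000) (root6 1)"
    unfolding mix_def r3 using sqrt_2_bounds root6_1_bounds by (simp add: field_simps)
  finally show "alpha_bound < 778 / 1000"
    using mix_at_1_le_iff(1)[of "778 / 1000"] by linarith
qed

section \<open>Best constants in the one-variable inequality\<close>

lemma mix_alpha_bound_less: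
  assumes "0 < v" "v < 1"
  shows "mix alpha_bound (root6 v) < v / arsinh v"
proof -
  have "mix alpha_bound (root6 1) = 1 / arsinh 1"
    using mix_at_1_le_iff[of alpha_bound] by simp
  then have "arsinh_gap alpha_bound 1 = 0" by (simp add: arsinh_gap_def)
  then show ?thesis
    using assms alpha_bound_bounds arsinh_gap_neg_if_zero_at_1[of alpha_bound v]
    by (subst mix_less_iff_arsinh_gap) auto
qed

text \<open>The value v = 1 would mean b = 0, so it is reached only as a left limit, which turns the
  strict inequality into a weak one.\<close>

lemma le_alpha_bound_if_mix_less:
  assumes "\<And>v. 0 < v \<Longrightarrow> v < 1 \<Longrightarrow> mix l (root6 v) < v / arsinh v"
  shows "l \<le> alpha_bound"
proof -
  have "isCont (\<lambda>v. v / arsinh v - mix l (root6 v)) 1"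
    unfolding mix_def
    by (intro continuous_intros DERIV_isCont[OF has_real_derivative_root6]) auto
  then have "((\<lambda>v. v / arsinh v - mix l (root6 v)) \<longlongrightarrow> 1 / arsinh 1 - mix l (root6 1)) (at_left 1)"
    unfolding isCont_def by (rule filterlim_mono) (auto simp: at_le)
  moreover have "\<forall>\<^sub>F v in at_left (1::real). 0 \<le> v / arsinh v - mix l (root6 v)"
    using eventually_at_left_real[of 0 1] assms by (auto elim!: eventually_mono intro: less_imp_le)
  ultimately have "0 \<le> 1 / arsinh 1 - mix l (root6 1)"
    by (rule tendsto_lowerbound) simp
  then show ?thesis using mix_at_1_le_iff(1)[of l] by simp
qed

lemma four_fifths_le_if_less_mix:
  assumes "\<And>v. 0 < v \<Longrightarrow> v < 1 \<Longrightarrow> v / arsinh v < mix l (root6 v)"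
  shows "4/5 \<le> l"
proof (rule ccontr)
  assume "\<not> 4/5 \<le> l"
  \<comment> \<open>Raising l to at least 3/4 meets the hypothesis of
    \<open>arsinh_gap_neg_near_0\<close>; as \<open>mix\<close> grows with l, the assumed upper
    bound survives.\<close>
  then have "3/4 \<le> max l (3/4)" "max l (3/4) < 4/5" by auto
  then obtain v where v: "0 < v" "v < 1" "arsinh_gap (max l (3/4)) v < 0"
    by (rule arsinh_gap_neg_near_0)
  then have "mix (max l (3/4)) (root6 v) < v / arsinh v"
    by (subst mix_less_iff_arsinh_gap) auto
  moreover have "mix l (root6 v) \<le> mix (max l (3/4)) (root6 v)"
    by (intro mix_mono root6_ge_1) simp
  ultimately show False using assms[OF v(1,2)] by simp
qed

section \<open>Reduction of the means to one variable\<close>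

lemma neuman_sandor_mean_eq:
  assumes "a > 0" "b > 0"
  shows "neuman_sandor_mean a b =
    arithmetic_mean a b * (\<bar>(a - b) / (a + b)\<bar> / arsinh \<bar>(a - b) / (a + b)\<bar>)"
proof -
  define v where "v = (a - b) / (a + b)"
  have "a - b = 2 * arithmetic_mean a b * v"
    using assms by (simp add: v_def arithmetic_mean_def)
  then have "neuman_sandor_mean a b = arithmetic_mean a b * (v / arsinh v)"
    unfolding neuman_sandor_mean_def v_def[symmetric] by simp
  \<comment> \<open>The quotient is even because \<open>arsinh\<close> is odd.\<close>
  also have "v / arsinh v = \<bar>v\<bar> / arsinh \<bar>v\<bar>" by (simp add: abs_if)
  finally show ?thesis by (simp add: v_def)
qed

lemma quadratic_mean_eq:
  assumes "a > 0" "b > 0"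
  shows "quadratic_mean a b = arithmetic_mean a b * root6 ((a - b) / (a + b)) ^ 3"
proof -
  have "(a\<^sup>2 + b\<^sup>2) / 2 = ((a + b) / 2)\<^sup>2 * (1 + ((a - b) / (a + b))\<^sup>2)"
    using assms by (simp add: divide_simps) algebra
  then show ?thesis using assms
    by (simp add: quadratic_mean_def arithmetic_mean_def root6_power3 real_sqrt_mult)
qed

lemma mean_combination_eq:
  assumes "a > 0" "b > 0"
  shows "l * (1/3 * quadratic_mean a b + 2/3 * arithmetic_mean a b)
      + (1 - l) * (quadratic_mean a b powr (1/3) * arithmetic_mean a b powr (2/3))
    = arithmetic_mean a b * mix l (root6 \<bar>(a - b) / (a + b)\<bar>)"
proof -
  define A where "A = arithmetic_mean a b"
  define x where "x = root6 ((a - b) / (a + b))"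
  have A: "A > 0" using assms by (simp add: A_def arithmetic_mean_def)
  have x: "x > 0" using root6_ge_1 by (simp add: x_def less_le_trans[OF zero_less_one])
  have Q: "quadratic_mean a b = A * x^3"
    using quadratic_mean_eq[OF assms] by (simp add: A_def x_def)
  have "(x^3) powr (1/3) = x" using x by (simp add: powr_powr flip: powr_numeral)
  moreover have "A powr (1/3) * A powr (2/3) = A"
    using A by (simp flip: powr_add)
  ultimately have "(A * x^3) powr (1/3) * A powr (2/3) = A * x"
    using A x by (simp add: powr_mult mult_ac)
  then show ?thesis
    unfolding Q A_def[symmetric] root6_abs x_def[symmetric] by (simp add: mix_def algebra_simps)
qed

text \<open>The common factor \<open>arithmetic_mean a b\<close> cancels, and
  \<open>\<bar>(a - b) / (a + b)\<bar>\<close> takes exactly the values in (0, 1).\<close>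

lemma neuman_sandor_bounds_iff:
  "(\<forall>a b :: real. a > 0 \<and> b > 0 \<and> a \<noteq> b \<longrightarrow>
      \<alpha> * (1/3 * quadratic_mean a b + 2/3 * arithmetic_mean a b)
        + (1 - \<alpha>) * (quadratic_mean a b powr (1/3) * arithmetic_mean a b powr (2/3))
        < neuman_sandor_mean a b \<and>
      neuman_sandor_mean a b
        < \<beta> * (1/3 * quadratic_mean a b + 2/3 * arithmetic_mean a b)
        + (1 - \<beta>) * (quadratic_mean a b powr (1/3) * arithmetic_mean a b powr (2/3)))
    \<longleftrightarrow> (\<forall>v. 0 < v \<and> v < 1 \<longrightarrow>
          mix \<alpha> (root6 v) < v / arsinh v \<and> v / arsinh v < mix \<beta> (root6 v))"
  (is "(\<forall>a b. ?pos a b \<longrightarrow> ?P a b) \<longleftrightarrow> (\<forall>v. 0 < v \<and> v < 1 \<longrightarrow> ?R v)")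
proof -
  have P_iff: "?P a b \<longleftrightarrow> ?R \<bar>(a - b) / (a + b)\<bar>" if "a > 0" "b > 0" for a b
    unfolding mean_combination_eq[OF that] neuman_sandor_mean_eq[OF that]
    using that mult_less_cancel_left_pos[of "arithmetic_mean a b"]
    by (simp only: arithmetic_mean_def half_gt_zero_iff add_pos_pos)
  show ?thesis
  proof (intro iffI allI impI)
    fix v :: real
    assume "\<forall>a b. ?pos a b \<longrightarrow> ?P a b" and v: "0 < v \<and> v < 1"
    then have "?P (1 + v) (1 - v)" by simp
    then show "?R v" using v by (subst (asm) P_iff) auto
  next
    fix a b :: real
    assume R: "\<forall>v. 0 < v \<and> v < 1 \<longrightarrow> ?R v" and ab: "?pos a b"
    then have "0 < \<bar>(a - b) / (a + b)\<bar> \<and> \<bar>(a - b) / (a + b)\<bar> < 1"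
      by (auto simp: abs_less_iff field_simps)
    with R have "?R \<bar>(a - b) / (a + b)\<bar>" by blast
    then show "?P a b" using ab by (subst P_iff) auto
  qed
qed

theorem theorem1p1:
  fixes \<alpha> \<beta> :: real
  shows "((\<forall>a b :: real. a > 0 \<and> b > 0 \<and> a \<noteq> b \<longrightarrow>
            \<alpha> * (1/3 * quadratic_mean a b + 2/3 * arithmetic_mean a b)
              + (1 - \<alpha>) * (quadratic_mean a b powr (1/3) * arithmetic_mean a b powr (2/3))
              < neuman_sandor_mean a b \<and>
            neuman_sandor_mean a b
              < \<beta> * (1/3 * quadratic_mean a b + 2/3 * arithmetic_mean a b)
              + (1 - \<beta>) * (quadratic_mean a b powr (1/3) * arithmetic_mean a b powr (2/3)))
          \<longleftrightarrow> \<alpha> \<le> alpha_bound \<and> \<beta> \<ge> 4/5)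
         \<and> 0.777 \<le> alpha_bound \<and> alpha_bound < 0.778"
proof -
  \<comment> \<open>By monotonicity of \<open>mix\<close> in the parameter, both bounds follow from
    the extremal values \<open>alpha_bound\<close> and 4/5.\<close>
  have lower: "mix \<alpha> (root6 v) < v / arsinh v" if "\<alpha> \<le> alpha_bound" "0 < v" "v < 1" for v
    using mix_mono[OF that(1) root6_ge_1] mix_alpha_bound_less[OF that(2,3)] by (rule le_less_trans)
  have upper: "v / arsinh v < mix \<beta> (root6 v)" if "\<beta> \<ge> 4/5" "0 < v" for v
  proof -
    have "v / arsinh v < mix (4/5) (root6 v)"
      using arsinh_gap_four_fifths_pos that by (subst mix_less_iff_arsinh_gap) auto
    also have "\<dots> \<le> mix \<beta> (root6 v)" using that by (intro mix_mono root6_ge_1)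
    finally show ?thesis .
  qed
  show ?thesis
    unfolding neuman_sandor_bounds_iff
    using lower upper le_alpha_bound_if_mix_less[of \<alpha>] four_fifths_le_if_less_mix[of \<beta>]
      alpha_bound_bounds by auto
qed

end
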